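(* Let $X$ be a compact metric space, let $N\ge 1$ be an integer, and let $f:X\to X$ be an $N$-distal homeomorphism. If $\Omega(f)\subseteq AP(f)$, then the topological entropy of $f$ is zero.
   Context: Let $d$ be the metric of $X$. For $x\in X$, the proximal cell of $x$ is $P(x)=\{y\in X : \inf_{n\in\mathbb{Z}} d(f^n(x),f^n(y))=0\}$. The homeomorphism $f$ is $N$-distal if $P(x)$ has at most $N$ points for every $x\in X$. $\Omega(f)$ denotes the set of non-wandering points of $f$. $AP(f)$ denotes the set of almost periodic points of $f$: a point $x$ is almost periodic if for every neighborhood $U$ of $x$ the set $A=\{n\in\mathbb{Z} : f^n(x)\in U\}$ is syndetic, i.e. there is a finite set $F\subset\mathbb{Z}$ with $\mathbb{Z}=F+A$. The topological entropy of $f$ is the usual one; by the variational principle it equals $\sup_\mu h_\mu(f)$, where $\mu$ ranges over the ergodic $f$-invariant Borel probability measures and $h_\mu(f)$ is the metric (Kolmogorov–Sinai) entropy. *)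

theory Defs
  imports "HOL-Analysis.Analysis"
begin

text \<open>
  The space is a compact subset X of a metric-space type, and only the values of f on X matter.
\<close>

definition int_iterate :: "'a set \<Rightarrow> ('a \<Rightarrow> 'a) \<Rightarrow> int \<Rightarrow> 'a \<Rightarrow> 'a" where
  "int_iterate X f n =
     (if n \<ge> 0 then f ^^ nat n else inv_into X f ^^ nat (- n))"

definition proximal_cell :: "'a::metric_space set \<Rightarrow> ('a \<Rightarrow> 'a) \<Rightarrow> 'a \<Rightarrow> 'a set" where
  "proximal_cell X f x =
     {y \<in> X. (INF n. dist (int_iterate X f n x) (int_iterate X f n y)) = 0}"

definition N_distal :: "nat \<Rightarrow> 'a::metric_space set \<Rightarrow> ('a \<Rightarrow> 'a) \<Rightarrow> bool" where
  "N_distal N X f \<longleftrightarrow>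
     (\<forall>x\<in>X. finite (proximal_cell X f x) \<and> card (proximal_cell X f x) \<le> N)"

definition nonwandering_set :: "'a::topological_space set \<Rightarrow> ('a \<Rightarrow> 'a) \<Rightarrow> 'a set" where
  "nonwandering_set X f =
     {x \<in> X. \<forall>U. openin (top_of_set X) U \<and> x \<in> U \<longrightarrow>
        (\<exists>n::nat. n \<ge> 1 \<and> (f ^^ n) ` U \<inter> U \<noteq> {})}"

definition syndetic :: "int set \<Rightarrow> bool" where
  "syndetic A \<longleftrightarrow> (\<exists>F. finite F \<and> UNIV = {k + a | k a. k \<in> F \<and> a \<in> A})"

definition almost_periodic_points :: "'a::topological_space set \<Rightarrow> ('a \<Rightarrow> 'a) \<Rightarrow> 'a set" where
  "almost_periodic_points X f =
     {x \<in> X. \<forall>U. openin (top_of_set X) U \<and> x \<in> U \<longrightarrow>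
        syndetic {n. int_iterate X f n x \<in> U}}"

text \<open>
  Topological entropy is Bowen's, by (n, e)-separated sets: two distinct points are more than e
  apart in the metric "maximum of the distances of the first n iterates".
\<close>

definition dyn_separated ::
    "'a::metric_space set \<Rightarrow> ('a \<Rightarrow> 'a) \<Rightarrow> nat \<Rightarrow> real \<Rightarrow> 'a set \<Rightarrow> bool" where
  "dyn_separated X f n e E \<longleftrightarrow>
     E \<subseteq> X \<and> (\<forall>x\<in>E. \<forall>y\<in>E. x \<noteq> y \<longrightarrow> (\<exists>i<n. dist ((f ^^ i) x) ((f ^^ i) y) > e))"

text \<open>
  For compact X, continuous f and e > 0 the cardinalities below are bounded, so the supremum in
  the natural numbers is a maximum; it is meaningless otherwise.
\<close>

definition max_separated :: "'a::metric_space set \<Rightarrow> ('a \<Rightarrow> 'a) \<Rightarrow> nat \<Rightarrow> real \<Rightarrow> nat" where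
  "max_separated X f n e = Sup {card E | E. finite E \<and> dyn_separated X f n e E}"

text \<open>
  The inner upper limit grows as e decreases, so the limit for e tending to 0 exists in the
  extended reals. For empty X the convention ln 0 = 0 makes the entropy 0.
\<close>

definition topological_entropy :: "'a::metric_space set \<Rightarrow> ('a \<Rightarrow> 'a) \<Rightarrow> ereal" where
  "topological_entropy X f =
     Lim (at_right 0)
       (\<lambda>e. limsup (\<lambda>n. ereal (ln (real (max_separated X f n e)) / real n)))"

end

theory Submission
  imports Defs
begin

text \<open>
  Suppose that for some \<open>e, h > 0\<close> there are, for infinitely many \<open>n\<close>, more than \<open>exp (h n)\<close>
  points that are \<open>(n, e)\<close>-separated.  Cover \<open>X\<close> by finitely many balls of radius \<open>1 / (2 (j + 1))\<close>
  and choose \<open>M\<^sub>j\<close> so large that recording the ball visited at each multiple of \<open>M\<^sub>j\<close> below \<open>n\<close>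
  costs only a factor \<open>exp (h n / 2^(j+2))\<close>.  By the pigeonhole principle more than \<open>exp (h n / 2)\<close>
  of the points share all these records, so they are \<open>1 / (j + 1)\<close>-close to each other at
  all multiples of \<open>M\<^sub>j\<close>.  Being so many, \<open>N + 1\<close> of them are pairwise separated in
  one time window whose length does not depend on \<open>n\<close>.  Moving this window to time \<open>0\<close> and passing
  to a limit gives \<open>N + 1\<close> distinct points that are pairwise \<open>1 / (j + 1)\<close>-close at
  some time in \<open>[-M\<^sub>j, 0]\<close>, for every \<open>j\<close>.  Such points lie in one proximal cell.
\<close>

section \<open>Pigeonhole selection of orbits with common records\<close>

text \<open>Treat the indices in \<open>T\<close> one at a time: among at most \<open>K\<close>
  labels, some label is shared by at least a fraction 1/\<open>K\<close> of the points still
  present. The labels may depend on \<open>t\<close> and need not lie in \<open>E\<close>, so the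
  lemma serves both for covers of the space by balls and for spanning sets of a time window.\<close>

lemma common_centre_subset:
  fixes R :: "'t \<Rightarrow> 'c \<Rightarrow> 'a \<Rightarrow> bool" and K :: nat
  assumes "finite T" and "finite E"
    and "\<And>t. t \<in> T \<Longrightarrow> \<exists>C. finite C \<and> card C \<le> K \<and> (\<forall>x\<in>E. \<exists>c\<in>C. R t c x)"
  shows "\<exists>E'\<subseteq>E. card E \<le> K ^ card T * card E' \<and> (\<forall>t\<in>T. \<exists>c. \<forall>x\<in>E'. R t c x)"
  using assms(1,3)
proof (induction T rule: finite_induct)
  case empty
  then show ?case by auto
next
  case (insert t T)
  then obtain E1 where E1: "E1 \<subseteq> E" "card E \<le> K ^ card T * card E1"
    "\<forall>t\<in>T. \<exists>c. \<forall>x\<in>E1. R t c x" by (metis insertI2)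
  obtain C where C: "finite C" "card C \<le> K" "\<forall>x\<in>E. \<exists>c\<in>C. R t c x"
    using insert.prems by blast
  have fin1: "finite E1" using E1(1) assms(2) finite_subset by blast
  show ?case
  proof (cases "E1 = {}")
    case True
    then show ?thesis using E1 by auto
  next
    case False
    define F where "F c = {x\<in>E1. R t c x}" for c
    have "\<exists>c\<in>C. card E1 \<le> K * card (F c)"
    proof (rule ccontr)
      assume "\<not> ?thesis"
      then have lt: "K * card (F c) < card E1" if "c \<in> C" for c using that by (meson not_less)
      \<comment> \<open>Summing the assumed bounds over \<open>C\<close> gives a strict inequality
        only if \<open>C\<close> is nonempty, which is why an empty \<open>E1\<close> is treated
        separately.\<close>
      have "C \<noteq> {}" using False C(3) E1(1) by blast
      have "E1 \<subseteq> (\<Union>c\<in>C. F c)" using C(3) E1(1) by (auto simp: F_def)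
      then have "card E1 \<le> card (\<Union>c\<in>C. F c)"
        using fin1 C(1) by (intro card_mono) (auto simp: F_def)
      also have "\<dots> \<le> (\<Sum>c\<in>C. card (F c))" using C(1) by (rule card_UN_le)
      finally have "K * card E1 \<le> (\<Sum>c\<in>C. K * card (F c))"
        by (simp flip: sum_distrib_left)
      also have "\<dots> < (\<Sum>c\<in>C. card E1)"
        using C(1) \<open>C \<noteq> {}\<close> lt by (rule sum_strict_mono)
      also have "\<dots> \<le> K * card E1" using C(2) by simp
      finally show False by simp
    qed
    then obtain c where c: "card E1 \<le> K * card (F c)" by blast
    have "card E \<le> K ^ card T * (K * card (F c))"
      using E1(2) c by (meson le_trans mult_le_mono2)
    moreover have "\<forall>s\<in>insert t T. \<exists>c'. \<forall>x\<in>F c. R s c' x"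
      using E1(3) unfolding F_def by blast
    moreover have "F c \<subseteq> E" using E1(1) by (auto simp: F_def)
    ultimately show ?thesis using insert.hyps
      by (intro exI[of _ "F c"]) (simp add: mult.assoc mult.left_commute)
  qed
qed

text \<open>This is the price of \<open>n div M + 1\<close> records with \<open>K\<close> values
  each. The factor 2 in the second hypothesis absorbs the extra record: for \<open>M\<close> \<le>
  \<open>n\<close> there are at most 2\<open>n\<close>/\<open>M\<close> of them.\<close>

lemma power_div_le_exp:
  fixes K M n :: nat and a :: real
  assumes "K \<ge> 1" and "2 * ln K \<le> a * M" and "0 < M" and "M \<le> n"
  shows "real K ^ (n div M + 1) \<le> exp (a * n)"
proof -
  have lnK: "0 \<le> ln (real K)" using assms(1) by simp
  have "n div M * M \<le> n" by (rule div_times_less_eq_dividend)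
  then have "(n div M + 1) * M \<le> 2 * n" using assms(4) unfolding add_mult_distrib by linarith
  then have q: "real (n div M + 1) * M \<le> 2 * n"
    by (metis of_nat_le_iff of_nat_mult)
  have "real (n div M + 1) * ln K * M = (real (n div M + 1) * M) * ln K" by simp
  also have "\<dots> \<le> (2 * n) * ln K" using q lnK by (rule mult_right_mono)
  also have "\<dots> = n * (2 * ln K)" by simp
  also have "\<dots> \<le> n * (a * M)" using assms(2) by (intro mult_left_mono) auto
  finally have "real (n div M + 1) * ln K * M \<le> (a * n) * M" by (simp add: algebra_simps)
  then have "real (n div M + 1) * ln K \<le> a * n" using assms(3) by simp
  moreover have "real K ^ (n div M + 1) = exp (real (n div M + 1) * ln K)"
    using assms(1) by (subst exp_of_nat_mult) simp
  ultimately show ?thesis by (metis exp_le_cancel_iff)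
qed

lemma close_subset:
  fixes X :: "'a::metric_space set" and K M n :: nat
  assumes "finite E" "E \<subseteq> X" "\<And>x. x \<in> X \<Longrightarrow> f x \<in> X"
    and "finite C" "card C \<le> K" "X \<subseteq> (\<Union>c\<in>C. ball c (\<delta> / 2))"
  shows "\<exists>E'\<subseteq>E. card E \<le> K ^ (n div M + 1) * card E' \<and>
    (\<forall>x\<in>E'. \<forall>y\<in>E'. \<forall>i\<le>n div M. dist ((f ^^ (i * M)) x) ((f ^^ (i * M)) y) < \<delta>)"
proof -
  have iter: "(f ^^ i) x \<in> X" if "x \<in> X" for i x
    using that by (induction i) (simp_all add: assms(3))
  have cover: "\<forall>x\<in>E. \<exists>c\<in>C. (f ^^ (i * M)) x \<in> ball c (\<delta> / 2)" for i
  proof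
    fix x assume "x \<in> E"
    then have "(f ^^ (i * M)) x \<in> (\<Union>c\<in>C. ball c (\<delta> / 2))"
      using iter assms(2,6) by (meson subsetD)
    then show "\<exists>c\<in>C. (f ^^ (i * M)) x \<in> ball c (\<delta> / 2)" by (simp only: UN_iff)
  qed
  have "\<exists>E'\<subseteq>E. card E \<le> K ^ card {..n div M} * card E' \<and>
      (\<forall>i\<in>{..n div M}. \<exists>c. \<forall>x\<in>E'. (f ^^ (i * M)) x \<in> ball c (\<delta> / 2))"
    by (rule common_centre_subset[OF finite_atMost assms(1)])
      (intro exI[of _ C] conjI assms(4,5) cover)
  then obtain E' where E': "E' \<subseteq> E" "card E \<le> K ^ card {..n div M} * card E'"
    "\<forall>i\<in>{..n div M}. \<exists>c. \<forall>x\<in>E'. (f ^^ (i * M)) x \<in> ball c (\<delta> / 2)"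
    by (elim exE conjE)
  have "dist ((f ^^ (i * M)) x) ((f ^^ (i * M)) y) < \<delta>"
    if xy: "x \<in> E'" "y \<in> E'" "i \<le> n div M" for x y i
  proof -
    obtain c where c: "\<forall>x\<in>E'. (f ^^ (i * M)) x \<in> ball c (\<delta> / 2)"
      using E'(3) xy(3) by (meson atMost_iff)
    have "dist c ((f ^^ (i * M)) x) < \<delta> / 2" "dist c ((f ^^ (i * M)) y) < \<delta> / 2"
      using bspec[OF c xy(1)] bspec[OF c xy(2)] by (simp_all only: mem_ball)
    then show ?thesis by (rule dist_triangle_half_r)
  qed
  moreover have "card E \<le> K ^ (n div M + 1) * card E'" using E'(2) by simp
  ultimately show ?thesis using E'(1) by blast
qed

text \<open>The exponents form a geometric budget. Scale \<open>j\<close> spends h/2^(j+2), so after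
  \<open>J\<close> scales the rate has dropped from h to h/2 + h/2^(J+1). It stays above h/2 however
  many scales are imposed.\<close>

lemma simultaneously_close_subset:
  fixes X :: "'a::metric_space set" and K M :: "nat \<Rightarrow> nat" and n :: nat and h :: real
  assumes "finite E" "E \<subseteq> X" "\<And>x. x \<in> X \<Longrightarrow> f x \<in> X"
    and "\<And>j. finite (C j)" "\<And>j. card (C j) \<le> K j"
    and "\<And>j. X \<subseteq> (\<Union>c\<in>C j. ball c (\<delta> j / 2))"
    and "\<And>j. K j \<ge> 1" "\<And>j. M j > 0" "\<And>j. 2 * ln (K j) \<le> h / 2 ^ (j + 2) * M j"
    and "\<And>j. j < J \<Longrightarrow> M j \<le> n"
    and "exp (h * n) < card E"
  shows "\<exists>E'\<subseteq>E. exp ((h / 2 + h / 2 ^ (J + 1)) * n) < card E' \<and>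
    (\<forall>j<J. \<forall>x\<in>E'. \<forall>y\<in>E'. \<forall>i\<le>n div M j.
      dist ((f ^^ (i * M j)) x) ((f ^^ (i * M j)) y) < \<delta> j)"
  using assms(10)
proof (induction J)
  case 0
  then show ?case using assms(11) by auto
next
  case (Suc J)
  then obtain E1 where E1: "E1 \<subseteq> E" "exp ((h / 2 + h / 2 ^ (J + 1)) * n) < card E1"
    "\<forall>j<J. \<forall>x\<in>E1. \<forall>y\<in>E1. \<forall>i\<le>n div M j.
      dist ((f ^^ (i * M j)) x) ((f ^^ (i * M j)) y) < \<delta> j"
    by (metis less_Suc_eq)
  have "finite E1" "E1 \<subseteq> X" using E1(1) assms(1,2) finite_subset by auto
  then have "\<exists>E2\<subseteq>E1. card E1 \<le> K J ^ (n div M J + 1) * card E2 \<and>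
      (\<forall>x\<in>E2. \<forall>y\<in>E2. \<forall>i\<le>n div M J.
        dist ((f ^^ (i * M J)) x) ((f ^^ (i * M J)) y) < \<delta> J)"
    by (rule close_subset[OF _ _ assms(3) assms(4)[of J] assms(5)[of J] assms(6)[of J]])
  then obtain E2 where E2: "E2 \<subseteq> E1" "card E1 \<le> K J ^ (n div M J + 1) * card E2"
    "\<forall>x\<in>E2. \<forall>y\<in>E2. \<forall>i\<le>n div M J.
      dist ((f ^^ (i * M J)) x) ((f ^^ (i * M J)) y) < \<delta> J" by (elim exE conjE)
  have "real (card E1) \<le> real (K J) ^ (n div M J + 1) * card E2"
    using E2(2) by (metis of_nat_le_iff of_nat_mult of_nat_power)
  also have "\<dots> \<le> exp (h / 2 ^ (J + 2) * n) * card E2"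
    using power_div_le_exp[OF assms(7,9,8), of J n] Suc.prems
    by (intro mult_right_mono) auto
  finally have "exp ((h / 2 + h / 2 ^ (J + 1)) * n) < exp (h / 2 ^ (J + 2) * n) * card E2"
    using E1(2) by linarith
  \<comment> \<open>The surplus h/2^(J+1) splits into two equal halves: one pays for the scale
    \<open>J\<close>, the other is the surplus that remains.\<close>
  moreover have "exp ((h / 2 + h / 2 ^ (J + 1)) * n)
      = exp (h / 2 ^ (J + 2) * n) * exp ((h / 2 + h / 2 ^ (Suc J + 1)) * n)"
    by (subst exp_add[symmetric]) (simp add: field_simps)
  ultimately have "exp ((h / 2 + h / 2 ^ (Suc J + 1)) * n) < card E2" by simp
  moreover have "\<forall>j<Suc J. \<forall>x\<in>E2. \<forall>y\<in>E2. \<forall>i\<le>n div M j.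
      dist ((f ^^ (i * M j)) x) ((f ^^ (i * M j)) y) < \<delta> j"
    using E1(3) E2(1,3) by (auto simp: less_Suc_eq)
  ultimately show ?case using E1(1) E2(1) by (intro exI[of _ E2]) auto
qed

section \<open>Separation within a window of bounded length\<close>

text \<open>The usual passage from separated to spanning sets: take \<open>S\<close> maximal under
  inclusion. A point \<open>Q\<close>-related to all of \<open>S\<close> could be added, hence would
  already lie in \<open>S\<close> and be \<open>Q\<close>-related to itself.\<close>

lemma maximal_pairwise_spanning:
  fixes Q :: "'a \<Rightarrow> 'a \<Rightarrow> bool" and N :: nat
  assumes "finite E" and sym: "\<And>x y. Q x y \<Longrightarrow> Q y x" and irrefl: "\<And>x. \<not> Q x x"
    and none: "\<nexists>S. S \<subseteq> E \<and> card S = N + 1 \<and> pairwise Q S"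
  shows "\<exists>S\<subseteq>E. card S \<le> N \<and> (\<forall>x\<in>E. \<exists>c\<in>S. \<not> Q c x)"
proof -
  let ?A = "{S. S \<subseteq> E \<and> pairwise Q S}"
  have "finite ?A" using assms(1) by simp
  moreover have "?A \<noteq> {}" by (intro ex_in_conv[THEN iffD1] exI[of _ "{}"]) simp
  ultimately obtain S where S: "S \<in> ?A" "\<forall>S'\<in>?A. S \<subseteq> S' \<longrightarrow> S = S'"
    using finite_has_maximal[of ?A] by metis
  have "card S \<le> N"
  proof (rule ccontr)
    assume "\<not> card S \<le> N"
    then obtain S' where "S' \<subseteq> S" "card S' = N + 1"
      by (metis Suc_eq_plus1 not_less_eq_eq obtain_subset_with_card_n)
    then show False using none S(1) pairwise_subset by blast
  qed
  moreover have "\<exists>c\<in>S. \<not> Q c x" if "x \<in> E" for x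
  proof (rule ccontr)
    assume neg: "\<not> ?thesis"
    then have "insert x S \<in> ?A" using that S(1) sym by (auto simp: pairwise_insert)
    then show False using S(2) neg irrefl by blast
  qed
  ultimately show ?thesis using S(1) by blast
qed

text \<open>Otherwise every window of length \<open>L\<close> is e/2-spanned by at most
  \<open>N\<close> points. Points with the same centres in all windows are e-close at all times
  below \<open>n\<close>, hence equal, so \<open>E\<close> has at most N^(n div L + 1) points, too
  few for its size.\<close>

lemma separated_in_window:
  fixes X :: "'a::metric_space set" and N L n :: nat and h e :: real
  assumes "dyn_separated X f n e E" "finite E" "0 < e"
    and "N \<ge> 1" "0 < L" "2 * ln N \<le> h * L" "L \<le> n"
    and "exp (h * n) < card E"
  shows "\<exists>k\<le>n. \<exists>S\<subseteq>E. card S = N + 1 \<and>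
    pairwise (\<lambda>x y. \<exists>i<L. dist ((f ^^ (k + i)) x) ((f ^^ (k + i)) y) > e / 2) S"
proof (rule ccontr)
  assume neg: "\<not> ?thesis"
  define R where "R w c x \<longleftrightarrow>
    (\<forall>i<L. dist ((f ^^ (w * L + i)) c) ((f ^^ (w * L + i)) x) \<le> e / 2)" for w c x
  have "\<exists>C. finite C \<and> card C \<le> N \<and> (\<forall>x\<in>E. \<exists>c\<in>C. R w c x)" if "w \<in> {..n div L}" for w
  proof -
    let ?Q = "\<lambda>x y. \<exists>i<L. dist ((f ^^ (w * L + i)) x) ((f ^^ (w * L + i)) y) > e / 2"
    \<comment> \<open>The windows starting at \<open>w * L\<close> for \<open>w\<close> \<le>
      \<open>n div L\<close> cover all times below \<open>n\<close>. The last one reaches beyond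
      \<open>n\<close>, which is harmless because the iterates exist at all times.\<close>
    have "w * L \<le> n" using that by (simp add: less_eq_div_iff_mult_less_eq assms(5))
    then have "\<nexists>S. S \<subseteq> E \<and> card S = N + 1 \<and> pairwise ?Q S" using neg by blast
    then obtain S where "S \<subseteq> E" "card S \<le> N" "\<forall>x\<in>E. \<exists>c\<in>S. \<not> ?Q c x"
      using maximal_pairwise_spanning[of E ?Q N] assms(2,3) by (auto simp: dist_commute)
    then show ?thesis using assms(2) finite_subset unfolding R_def by (meson not_less)
  qed
  then obtain E' where E': "E' \<subseteq> E" "card E \<le> N ^ card {..n div L} * card E'"
    "\<forall>w\<in>{..n div L}. \<exists>c. \<forall>x\<in>E'. R w c x"
    using common_centre_subset[of "{..n div L}" E N R] assms(2) by blast
  have "x = y" if xy: "x \<in> E'" "y \<in> E'" for x y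
  proof (rule ccontr)
    assume "x \<noteq> y"
    then obtain m where m: "m < n" "dist ((f ^^ m) x) ((f ^^ m) y) > e"
      using assms(1) E'(1) xy unfolding dyn_separated_def by blast
    have "m div L \<le> n div L" using m(1) by (simp add: div_le_mono)
    then obtain c where c: "\<forall>x\<in>E'. R (m div L) c x" using E'(3) by auto
    have "dist ((f ^^ m) c) ((f ^^ m) z) \<le> e / 2" if "z \<in> E'" for z
    proof -
      have "R (m div L) c z" using c that by blast
      then have "dist ((f ^^ (m div L * L + m mod L)) c) ((f ^^ (m div L * L + m mod L)) z) \<le> e / 2"
        unfolding R_def using assms(5) by (meson mod_less_divisor)
      then show ?thesis by simp
    qed
    from this[OF xy(1)] this[OF xy(2)] m(2) show False
      using dist_triangle3[of "(f ^^ m) x" "(f ^^ m) y" "(f ^^ m) c"] by linarith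
  qed
  then have "card E' \<le> 1" by (metis One_nat_def card_le_Suc0_iff_eq E'(1) assms(2) finite_subset)
  then have "card E \<le> N ^ (n div L + 1)"
    using E'(2) by (metis card_atMost Suc_eq_plus1 le_trans mult.right_neutral mult_le_mono2)
  then have "real (card E) \<le> real N ^ (n div L + 1)"
    by (metis of_nat_le_iff of_nat_power)
  also have "\<dots> \<le> exp (h * n)"
    using assms by (intro power_div_le_exp) auto
  finally show False using assms(8) by linarith
qed

section \<open>Limit configurations and proximal cells\<close>

lemma convergent_subsequence_finite_family:
  fixes p :: "nat \<Rightarrow> 'i \<Rightarrow> 'a::metric_space"
  assumes "compact X" "finite I" "\<And>n i. i \<in> I \<Longrightarrow> p n i \<in> X"
  shows "\<exists>r q. strict_mono r \<and> (\<forall>i\<in>I. q i \<in> X \<and> (\<lambda>n. p (r n) i) \<longlonglongrightarrow> q i)"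
  using assms(2,3)
proof (induction I rule: finite_induct)
  case empty
  then show ?case using strict_mono_id by blast
next
  case (insert i I)
  then obtain r q where r: "strict_mono r"
    "\<forall>i\<in>I. q i \<in> X \<and> (\<lambda>n. p (r n) i) \<longlonglongrightarrow> q i" by (metis insertI2)
  have "\<forall>n. p (r n) i \<in> X" using insert.prems by blast
  then obtain l s where s: "l \<in> X" "strict_mono s" "((\<lambda>n. p (r n) i) \<circ> s) \<longlonglongrightarrow> l"
    using assms(1) unfolding compact_def by metis
  have "(\<lambda>n. p (r (s n)) k) \<longlonglongrightarrow> q k" if "k \<in> I" for k
    using LIMSEQ_subseq_LIMSEQ[OF _ s(2), of "\<lambda>n. p (r n) k" "q k"] r(2) that by (auto simp: o_def)
  then have "\<forall>k\<in>insert i I. (q(i := l)) k \<in> X \<and> (\<lambda>n. p ((r \<circ> s) n) k) \<longlonglongrightarrow> (q(i := l)) k"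
    using r(2) s(1,3) by (auto simp: o_def)
  then show ?case using strict_mono_o[OF r(1) s(2)] by blast
qed

text \<open>The bounds \<open>L\<close> and \<open>M j\<close> do not depend on \<open>J\<close>, so
  each property involves finitely many continuous iterates and survives the limit. Separation at
  some time below \<open>L\<close> keeps the limits distinct; closeness becomes a weak
  inequality.\<close>

lemma mutually_proximal_limit:
  fixes X :: "'a::metric_space set" and p :: "nat \<Rightarrow> nat \<Rightarrow> 'a" and M :: "nat \<Rightarrow> nat"
    and \<delta> :: "nat \<Rightarrow> real" and L N :: nat and e :: real and f g :: "'a \<Rightarrow> 'a"
  assumes "compact X" "0 < e"
    and cf: "\<And>i. continuous_on X (f ^^ i)" and cg: "\<And>i. continuous_on X (g ^^ i)"
    and pX: "\<And>J i. i \<le> N \<Longrightarrow> p J i \<in> X"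
    and sep: "\<And>J i i'. i \<le> N \<Longrightarrow> i' \<le> N \<Longrightarrow> i \<noteq> i' \<Longrightarrow>
      \<exists>l<L. dist ((f ^^ l) (p J i)) ((f ^^ l) (p J i')) > e"
    and close: "\<And>J j i. j < J \<Longrightarrow> i \<le> N \<Longrightarrow>
      \<exists>t\<le>M j. dist ((g ^^ t) (p J i)) ((g ^^ t) (p J 0)) < \<delta> j"
  shows "\<exists>q. (\<forall>i\<le>N. q i \<in> X) \<and> inj_on q {..N} \<and>
    (\<forall>i\<le>N. \<forall>j. \<exists>t. dist ((g ^^ t) (q i)) ((g ^^ t) (q 0)) \<le> \<delta> j)"
proof -
  obtain r q where r: "strict_mono r"
    and q: "\<And>i. i \<le> N \<Longrightarrow> q i \<in> X" "\<And>i. i \<le> N \<Longrightarrow> (\<lambda>n. p (r n) i) \<longlonglongrightarrow> q i"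
    using convergent_subsequence_finite_family[OF assms(1), of "{..N}" p] pX
    by (metis atMost_iff finite_atMost)
  have lim: "(\<lambda>n. dist ((F ^^ t) (p (r n) i)) ((F ^^ t) (p (r n) i'))) \<longlonglongrightarrow>
      dist ((F ^^ t) (q i)) ((F ^^ t) (q i'))"
    if "continuous_on X (F ^^ t)" "i \<le> N" "i' \<le> N" for F :: "'a \<Rightarrow> 'a" and t i i'
    using that q pX by (intro tendsto_dist continuous_on_tendsto_compose[OF that(1)]) auto
  have "q i \<noteq> q i'" if i: "i \<le> N" "i' \<le> N" "i \<noteq> i'" for i i'
  proof
    assume eq: "q i = q i'"
    have "\<forall>\<^sub>F n in sequentially. dist ((f ^^ l) (p (r n) i)) ((f ^^ l) (p (r n) i')) < e" for l
      using lim[OF cf i(1,2)] eq assms(2) by (intro order_tendstoD(2)) auto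
    then have "\<forall>\<^sub>F n in sequentially. \<forall>l\<in>{..<L}.
        dist ((f ^^ l) (p (r n) i)) ((f ^^ l) (p (r n) i')) < e"
      by (intro eventually_ball_finite) auto
    then obtain n where "\<forall>l\<in>{..<L}. dist ((f ^^ l) (p (r n) i)) ((f ^^ l) (p (r n) i')) < e"
      unfolding eventually_sequentially by blast
    with sep[OF i, of "r n"] show False by (meson lessThan_iff less_asym)
  qed
  then have "inj_on q {..N}" by (auto simp: inj_on_def)
  moreover have "\<exists>t. dist ((g ^^ t) (q i)) ((g ^^ t) (q 0)) \<le> \<delta> j" if i: "i \<le> N" for i j
  proof (rule ccontr)
    assume "\<not> ?thesis"
    then have "\<forall>\<^sub>F n in sequentially. dist ((g ^^ t) (p (r n) i)) ((g ^^ t) (p (r n) 0)) > \<delta> j" for t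
      using lim[OF cg i, of 0 t] by (intro order_tendstoD(1)) (auto simp: not_le)
    then have "\<forall>\<^sub>F n in sequentially. \<forall>t\<in>{..M j}.
        dist ((g ^^ t) (p (r n) i)) ((g ^^ t) (p (r n) 0)) > \<delta> j"
      by (intro eventually_ball_finite) auto
    moreover have "\<forall>\<^sub>F n in sequentially. n > j" by (rule eventually_gt_at_top)
    ultimately have "\<forall>\<^sub>F n in sequentially. n > j \<and> (\<forall>t\<in>{..M j}.
        dist ((g ^^ t) (p (r n) i)) ((g ^^ t) (p (r n) 0)) > \<delta> j)"
      by eventually_elim auto
    then obtain n where n: "n > j" "\<forall>t\<in>{..M j}.
        dist ((g ^^ t) (p (r n) i)) ((g ^^ t) (p (r n) 0)) > \<delta> j"
      unfolding eventually_sequentially by blast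
    \<comment> \<open>A subsequence index satisfies \<open>r n\<close> \<ge> \<open>n\<close>, so
      scale \<open>j\<close> is already among those imposed on the configuration
      \<open>p (r n)\<close>.\<close>
    have "r n > j" using n(1) seq_suble[OF r, of n] by linarith
    from close[OF this i] n(2) show False by (meson atMost_iff less_asym)
  qed
  ultimately show ?thesis using q(1) by blast
qed

text \<open>The infimum runs over all integers, so approaching each other at backward times is
  enough.\<close>

lemma mem_proximal_cell:
  fixes X :: "'a::metric_space set"
  assumes "y \<in> X" "\<delta> \<longlonglongrightarrow> 0"
    and "\<And>j. \<exists>t. dist ((inv_into X f ^^ t) y) ((inv_into X f ^^ t) x) \<le> \<delta> j"
  shows "y \<in> proximal_cell X f x"
proof -
  let ?d = "\<lambda>n. dist (int_iterate X f n x) (int_iterate X f n y)"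
  have bdd: "bdd_below (range ?d)" by (rule bdd_belowI[of _ 0]) auto
  have "\<exists>n. ?d n \<le> \<delta> j" for j
  proof -
    obtain t where t: "dist ((inv_into X f ^^ t) y) ((inv_into X f ^^ t) x) \<le> \<delta> j"
      using assms(3) by blast
    \<comment> \<open>The time 0 falls under the forward branch of \<open>int_iterate\<close>; both
      branches give the identity there.\<close>
    have "int_iterate X f (- int t) z = (inv_into X f ^^ t) z" for z
      by (cases "t = 0") (auto simp: int_iterate_def)
    then have "?d (- int t) \<le> \<delta> j" using t by (simp add: dist_commute)
    then show ?thesis by blast
  qed
  then have "(INF n. ?d n) \<le> \<delta> j" for j
    using cINF_lower2[OF bdd] by (metis UNIV_I)
  then have "(INF n. ?d n) \<le> 0" using assms(2) by (meson LIMSEQ_le_const)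
  moreover have "(INF n. ?d n) \<ge> 0" by (intro cINF_greatest) auto
  ultimately show ?thesis using assms(1) by (simp add: proximal_cell_def)
qed

section \<open>Subexponential growth of separated sets\<close>

lemma separated_card_le_exp:
  fixes X :: "'a::metric_space set" and N :: nat and e h :: real
  assumes "compact X" "N \<ge> 1" "homeomorphism X X f g" "N_distal N X f" "0 < e" "0 < h"
  shows "\<exists>n0. \<forall>n\<ge>n0. \<forall>E. finite E \<and> dyn_separated X f n e E \<longrightarrow> card E \<le> exp (h * n)"
proof (rule ccontr)
  assume "\<not> ?thesis"
  then have big: "\<exists>n\<ge>n0. \<exists>E. finite E \<and> dyn_separated X f n e E \<and> exp (h * n) < card E" for n0
    by (meson not_less)
  \<comment> \<open>Backward orbits in \<open>int_iterate\<close> use \<open>inv_into\<close>, which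
    agrees with the given inverse \<open>g\<close> on \<open>X\<close> only.\<close>
  define G where "G = inv_into X f"
  have fX: "f x \<in> X" "g x \<in> X" and gf: "g (f x) = x" and fg: "f (g x) = x" if "x \<in> X" for x
    using assms(3) that by (auto simp: homeomorphism_def)
  have G: "G x = g x" if "x \<in> X" for x
    unfolding G_def using that fX gf fg by (intro inv_into_f_eq) (auto intro!: inj_on_inverseI[of _ g])
  have GX: "G x \<in> X" if "x \<in> X" for x using that G fX by simp
  have cont: "continuous_on X f" "continuous_on X G"
    using assms(3) G by (auto simp: homeomorphism_def cong: continuous_on_cong)
  have iter: "(F ^^ i) x \<in> X" if "x \<in> X" "\<And>x. x \<in> X \<Longrightarrow> F x \<in> X" for F i x
    using that by (induction i) auto
  have citer: "continuous_on X (F ^^ i)"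
    if "continuous_on X F" "\<And>x. x \<in> X \<Longrightarrow> F x \<in> X" for F i
  proof (induction i)
    case (Suc i)
    show ?case unfolding funpow.simps using Suc that
      by (intro continuous_on_compose) (auto intro: continuous_on_subset iter)
  qed simp
  have G_iter_f_iter: "(G ^^ t) ((f ^^ (s + t)) x) = (f ^^ s) x" if "x \<in> X" for s t x
  proof (induction t)
    case (Suc t)
    have "(f ^^ (s + t)) x \<in> X" using that fX(1) by (intro iter)
    then have "G ((f ^^ (s + Suc t)) x) = (f ^^ (s + t)) x" using G fX gf by simp
    then show ?case using Suc by (simp add: funpow_swap1)
  qed simp
  define \<delta> where "\<delta> j = inverse (real (Suc j))" for j
  have "\<exists>C. finite C \<and> X \<subseteq> (\<Union>c\<in>C. ball c (\<delta> j / 2))" for j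
    using assms(1) unfolding compact_eq_totally_bounded by (auto simp: \<delta>_def)
  then obtain C where C: "\<And>j. finite (C j)" "\<And>j. X \<subseteq> (\<Union>c\<in>C j. ball c (\<delta> j / 2))" by metis
  \<comment> \<open>The maximum with 1 covers the case of an empty cover.\<close>
  define K where "K j = max 1 (card (C j))" for j
  have K: "card (C j) \<le> K j" "K j \<ge> 1" for j by (auto simp: K_def)
  have arch: "\<exists>m::nat. 0 < m \<and> a \<le> b * m" if "0 < b" for a b :: real
  proof -
    obtain m :: nat where "a / b \<le> m" using real_arch_simple by blast
    then have "a \<le> b * Suc m" using that by (simp add: field_simps)
    then show ?thesis by (intro exI[of _ "Suc m"]) simp
  qed
  \<comment> \<open>\<open>M j\<close> is fixed before \<open>J\<close> and \<open>n\<close>; this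
    gives the uniform time bounds needed for the limit.\<close>
  have "\<exists>m::nat. 0 < m \<and> 2 * ln (K j) \<le> h / 2 ^ (j + 2) * m" for j
    using arch[of "h / 2 ^ (j + 2)" "2 * ln (K j)"] assms(6) by simp
  then obtain M :: "nat \<Rightarrow> nat" where M: "\<And>j. 0 < M j"
    "\<And>j. 2 * ln (K j) \<le> h / 2 ^ (j + 2) * M j" by metis
  \<comment> \<open>The window length is adapted to the rate h/2, which remains available after any
    number of scales.\<close>
  obtain L :: nat where L: "0 < L" "2 * ln N \<le> h / 2 * L"
    using arch[of "h / 2" "2 * ln N"] assms(6) by auto
  have "\<exists>p. (\<forall>i\<le>N. p i \<in> X) \<and>
      (\<forall>i\<le>N. \<forall>i'\<le>N. i \<noteq> i' \<longrightarrow> (\<exists>l<L. dist ((f ^^ l) (p i)) ((f ^^ l) (p i')) > e / 2)) \<and>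
      (\<forall>j<J. \<forall>i\<le>N. \<exists>t\<le>M j. dist ((G ^^ t) (p i)) ((G ^^ t) (p 0)) < \<delta> j)" for J
  proof -
    \<comment> \<open>The sum makes \<open>n\<close> at least \<open>L\<close> and at least every
      \<open>M j\<close> with \<open>j\<close> < \<open>J\<close>.\<close>
    obtain n E where nE: "n \<ge> L + (\<Sum>j<J. M j)" "finite E" "dyn_separated X f n e E"
      "exp (h * n) < card E" using big by blast
    have EX: "E \<subseteq> X" using nE(3) by (simp add: dyn_separated_def)
    have Mn: "M j \<le> n" if "j < J" for j
      using nE(1) member_le_sum[of j "{..<J}" M] that by auto
    have "\<exists>E'\<subseteq>E. exp ((h / 2 + h / 2 ^ (J + 1)) * n) < card E' \<and>
        (\<forall>j<J. \<forall>x\<in>E'. \<forall>y\<in>E'. \<forall>i\<le>n div M j.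
          dist ((f ^^ (i * M j)) x) ((f ^^ (i * M j)) y) < \<delta> j)"
      by (rule simultaneously_close_subset[OF nE(2) EX fX(1) C(1) K(1) C(2) K(2) M Mn nE(4)])
    then obtain E1 where E1: "E1 \<subseteq> E" "exp ((h / 2 + h / 2 ^ (J + 1)) * n) < card E1"
      "\<forall>j<J. \<forall>x\<in>E1. \<forall>y\<in>E1. \<forall>i\<le>n div M j.
        dist ((f ^^ (i * M j)) x) ((f ^^ (i * M j)) y) < \<delta> j" by (elim exE conjE)
    have "h / 2 * n \<le> (h / 2 + h / 2 ^ (J + 1)) * n"
      using assms(6) by (intro mult_right_mono) auto
    then have "exp (h / 2 * n) \<le> exp ((h / 2 + h / 2 ^ (J + 1)) * n)" by simp
    then have "exp (h / 2 * n) < card E1" using E1(2) by linarith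
    moreover have "dyn_separated X f n e E1"
      using nE(3) E1(1) unfolding dyn_separated_def by (meson subset_iff)
    moreover have "finite E1" using E1(1) nE(2) by (rule finite_subset)
    ultimately obtain k S where k: "k \<le> n" and S: "S \<subseteq> E1" "card S = N + 1"
      "pairwise (\<lambda>x y. \<exists>i<L. dist ((f ^^ (k + i)) x) ((f ^^ (k + i)) y) > e / 2) S"
      using separated_in_window[of X f n e E1 N L "h / 2"] assms(2,5,6) L nE(1) by auto
    have "finite S" using S(2) card.infinite by fastforce
    then obtain s where s: "bij_betw s {..<N + 1} S"
      using S(2) ex_bij_betw_nat_finite by (metis atLeast0LessThan)
    have sS: "s i \<in> S" "s i \<in> E1" "s i \<in> X" if "i \<le> N" for i
    proof -
      show "s i \<in> S" using bij_betwE[OF s] that by simp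
      then show "s i \<in> E1" using S(1) by blast
      then show "s i \<in> X" using E1(1) EX by blast
    qed
    have sne: "s i \<noteq> s i'" if "i \<le> N" "i' \<le> N" "i \<noteq> i'" for i i'
      using bij_betw_imp_inj_on[OF s] that by (auto simp: inj_on_def)
    define p where "p i = (f ^^ k) (s i)" for i
    have "\<forall>i\<le>N. p i \<in> X" using sS(3) fX(1) by (auto simp: p_def intro!: iter)
    moreover have "\<exists>l<L. dist ((f ^^ l) (p i)) ((f ^^ l) (p i')) > e / 2"
      if i: "i \<le> N" "i' \<le> N" "i \<noteq> i'" for i i'
      using pairwiseD[OF S(3) sS(1)[OF i(1)] sS(1)[OF i(2)] sne[OF i]]
      by (simp add: p_def funpow_add add.commute[of k])
    moreover have "\<exists>t\<le>M j. dist ((G ^^ t) (p i)) ((G ^^ t) (p 0)) < \<delta> j"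
      if i: "i \<le> N" and j: "j < J" for i j
    proof (intro exI conjI)
      \<comment> \<open>Going back \<open>k mod M j\<close> steps from time \<open>k\<close> reaches
        the last multiple of \<open>M j\<close> not after \<open>k\<close>. There the selected
        points are close, since \<open>k\<close> \<le> \<open>n\<close> keeps this multiple among
        the recorded times.\<close>
      show "k mod M j \<le> M j" using M(1) by (simp add: less_imp_le)
      have "(G ^^ (k mod M j)) (p i) = (f ^^ (k div M j * M j)) (s i)" if "i \<le> N" for i
        using G_iter_f_iter[OF sS(3)[OF that], of "k mod M j" "k div M j * M j"]
        by (simp only: p_def div_mult_mod_eq)
      moreover have "k div M j \<le> n div M j" using k by (rule div_le_mono)
      ultimately show "dist ((G ^^ (k mod M j)) (p i)) ((G ^^ (k mod M j)) (p 0)) < \<delta> j"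
        using E1(3) i j sS(2) by auto
    qed
    ultimately show ?thesis by blast
  qed
  then obtain p where p: "\<And>J i. i \<le> N \<Longrightarrow> p J i \<in> X"
    "\<And>J i i'. i \<le> N \<Longrightarrow> i' \<le> N \<Longrightarrow> i \<noteq> i' \<Longrightarrow>
      \<exists>l<L. dist ((f ^^ l) (p J i)) ((f ^^ l) (p J i')) > e / 2"
    "\<And>J j i. j < J \<Longrightarrow> i \<le> N \<Longrightarrow> \<exists>t\<le>M j. dist ((G ^^ t) (p J i)) ((G ^^ t) (p J 0)) < \<delta> j"
    by metis
  have "\<exists>q. (\<forall>i\<le>N. q i \<in> X) \<and> inj_on q {..N} \<and>
      (\<forall>i\<le>N. \<forall>j. \<exists>t. dist ((G ^^ t) (q i)) ((G ^^ t) (q 0)) \<le> \<delta> j)"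
  proof (rule mutually_proximal_limit[OF assms(1)])
    show "0 < e / 2" using assms(5) by simp
    show "continuous_on X (f ^^ i)" "continuous_on X (G ^^ i)" for i
      by (intro citer cont GX fX(1); assumption)+
  qed (fact p)+
  then obtain q where q: "\<And>i. i \<le> N \<Longrightarrow> q i \<in> X" "inj_on q {..N}"
    "\<And>i j. i \<le> N \<Longrightarrow> \<exists>t. dist ((G ^^ t) (q i)) ((G ^^ t) (q 0)) \<le> \<delta> j" by blast
  have "\<delta> \<longlonglongrightarrow> 0" unfolding \<delta>_def by (rule LIMSEQ_inverse_real_of_nat)
  \<comment> \<open>These are \<open>N + 1\<close> distinct points in one cell, \<open>q 0\<close>
    itself included.\<close>
  then have "q ` {..N} \<subseteq> proximal_cell X f (q 0)"
    using q(1,3) unfolding G_def by (auto intro!: mem_proximal_cell)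
  moreover have "finite (proximal_cell X f (q 0))" "card (proximal_cell X f (q 0)) \<le> N"
    using assms(4) q(1) by (auto simp: N_distal_def)
  ultimately have "card (q ` {..N}) \<le> N" by (meson card_mono le_trans)
  then show False using card_image[OF q(2)] by simp
qed

section \<open>Vanishing of the entropy\<close>

lemma limsup_max_separated:
  fixes X :: "'a::metric_space set" and N :: nat and e :: real
  assumes "compact X" "N \<ge> 1" "homeomorphism X X f g" "N_distal N X f" "0 < e"
  shows "limsup (\<lambda>n. ereal (ln (real (max_separated X f n e)) / real n)) = 0"
proof (rule antisym)
  show "limsup (\<lambda>n. ereal (ln (real (max_separated X f n e)) / real n)) \<le> 0"
  proof (rule ereal_le_epsilon2)
    fix h :: real assume h: "0 < h"
    obtain n0 where n0: "\<And>n E. n \<ge> n0 \<Longrightarrow> finite E \<Longrightarrow> dyn_separated X f n e E \<Longrightarrow>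
        card E \<le> exp (h * n)"
      using separated_card_le_exp[OF assms h] by blast
    have "ln (real (max_separated X f n e)) / real n \<le> h" if n: "n \<ge> max 1 n0" for n
    proof -
      \<comment> \<open>The supremum is taken in the natural numbers, so the real bound is first
        rounded down.\<close>
      have "max_separated X f n e \<le> nat \<lfloor>exp (h * n)\<rfloor>"
        unfolding max_separated_def
      proof (rule cSup_least)
        have "dyn_separated X f n e {}" by (simp add: dyn_separated_def)
        then show "{card E |E. finite E \<and> dyn_separated X f n e E} \<noteq> {}" by blast
      qed (use n n0 in \<open>auto simp: le_nat_floor\<close>)
      then have "real (max_separated X f n e) \<le> exp (h * n)"
        by (meson exp_ge_zero of_nat_floor of_nat_le_iff order_trans)
      then have "ln (real (max_separated X f n e)) \<le> h * n"
        using h ln_mono[of "real (max_separated X f n e)" "exp (h * n)"]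
        by (cases "max_separated X f n e = 0") auto
      then show ?thesis using n by (simp add: field_simps)
    qed
    then show "limsup (\<lambda>n. ereal (ln (real (max_separated X f n e)) / real n)) \<le> 0 + ereal h"
      by (intro Limsup_bounded eventually_sequentiallyI[of "max 1 n0"]) auto
  qed
  \<comment> \<open>For \<open>m\<close> = 0 this rests on the convention ln 0 = 0.\<close>
  have "0 \<le> ln (real m)" for m :: nat by (cases m) auto
  then show "0 \<le> limsup (\<lambda>n. ereal (ln (real (max_separated X f n e)) / real n))"
    by (intro le_Limsup) (auto intro!: always_eventually)
qed

theorem theorem4p1:
  fixes X :: "'a::metric_space set" and f :: "'a \<Rightarrow> 'a" and N :: nat
  assumes "compact X"
    and "N \<ge> 1"
    and "\<exists>g. homeomorphism X X f g"
    and "N_distal N X f"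
    and "nonwandering_set X f \<subseteq> almost_periodic_points X f"
  shows "topological_entropy X f = 0"
proof -
  have "limsup (\<lambda>n. ereal (ln (real (max_separated X f n e)) / real n)) = 0" if "0 < e" for e
    using limsup_max_separated assms(1-4) that by blast
  \<comment> \<open>The inner upper limit is 0 at every positive scale, so the outer limit is that
    of an eventually constant function.\<close>
  then have "\<forall>\<^sub>F e in at_right 0.
      limsup (\<lambda>n. ereal (ln (real (max_separated X f n e)) / real n)) = 0"
    by (simp add: eventually_at_right_less eventually_mono[OF eventually_at_right_less])
  then have "((\<lambda>e. limsup (\<lambda>n. ereal (ln (real (max_separated X f n e)) / real n))) \<longlongrightarrow> 0)
      (at_right 0)"
    by (rule tendsto_eventually)
  then show ?thesis unfolding topological_entropy_def
    by (intro tendsto_Lim) auto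
qed

end
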